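(* Let $n\ge 1$, let $\mathcal{P}_n$ be the trivial unit interval positroid of rank $n$ on the ground set $[2n]$, and let $\mathcal{P}_{n+1}$ be the trivial unit interval positroid of rank $n+1$ on $[2(n+1)]$. Apply the algorithm $\gamma$ (described in the context) to the externally ordered poset $\mathrm{Ex}(\mathcal{P}_n)$. Then the collection of sets produced by $\gamma$ is exactly the set of bases of $\mathcal{P}_{n+1}$, and the partial order on these sets induced by $\gamma$ (the reflexive–transitive closure of the relations recorded by $\gamma$) is the external order $\le_{\mathrm{Ext}}$ of $\mathcal{P}_{n+1}$; that is, $\gamma(\mathrm{Ex}(\mathcal{P}_n))=\mathrm{Ex}(\mathcal{P}_{n+1})$.
   Context: For $m\ge1$, the trivial unit interval positroid $\mathcal{P}_m$ is the matroid on the ground set $[2m]=\{1,\dots,2m\}$ (with its natural linear order) whose bases are the sets of column indices of maximal linearly independent sets of columns of the real $m\times 2m$ matrix whose first $m$ columns form the identity matrix $I_m$ and each of whose columns $m+1,\dots,2m$ equals the vector with entry $(-1)^{m-i}$ in row $i$ (this is the matrix obtained from the all-ones $m\times m$ antiadjacency matrix of the $m$-element antichain via Postnikov's map). A circuit is a minimal dependent set. For a basis $A$, an element $e\in[2m]$ is active with respect to $A$ if there is a circuit $C$ with $e\in C\subseteq A\cup\{e\}$ and $e=\min C$; $\mathrm{Ext}(A)$ is the set of active elements not in $A$. The external order on bases is $A\le_{\mathrm{Ext}} B$ iff $A\subseteq B\cup\mathrm{Ext}(B)$, and $\mathrm{Ex}(\mathcal{P}_m)$ denotes the set of bases of $\mathcal{P}_m$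 with this order. The algorithm $\gamma$, applied to $\mathrm{Ex}(\mathcal{P}_n)$: (1) "Reinforce": for each basis $B$ of $\mathcal{P}_n$, form $(B+1)\cup\{\min B\}$ where $B+1=\{b+1:b\in B\}$; these sets are ordered as the corresponding $B$ are in $\mathrm{Ex}(\mathcal{P}_n)$. (2) "Build up": for each set $B$ from step 1 with $2n+1\in B$, form $(B\setminus\{2n+1\})\cup\{2n+2\}$, declared to cover $B$. (3) "Grow spine": for each set $B$ from steps 1 and 2 with $2\in B$, form $(B\setminus\{2\})\cup\{1\}$, declared to be covered by $B$.
   Formalization: Step 3 is applied only to sets B with 2 in B and 1 not in B (else {1,2} gives {1}), and the sets formed in steps 2 and 3 are also ordered among themselves as the sets they come from (else for n=1 the relation {1,3} ≤ {1,4} is missing); as written the claim fails. *)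

theory Defs
  imports "Jordan_Normal_Form.VS_Connect"
begin

section \<open>Matroids on subsets of the natural numbers\<close>

text \<open>A matroid is given by its ground set and its set of bases.\<close>

type_synonym matroid = "nat set \<times> nat set set"

abbreviation ground :: "matroid \<Rightarrow> nat set" where
  "ground P \<equiv> fst P"

abbreviation bases :: "matroid \<Rightarrow> nat set set" where
  "bases P \<equiv> snd P"

definition dependent_set :: "matroid \<Rightarrow> nat set \<Rightarrow> bool" where
  "dependent_set P X \<longleftrightarrow> X \<subseteq> ground P \<and> \<not> (\<exists>B \<in> bases P. X \<subseteq> B)"

definition circuit :: "matroid \<Rightarrow> nat set \<Rightarrow> bool" where
  "circuit P C \<longleftrightarrow> dependent_set P C \<and> (\<forall>D. D \<subset> C \<longrightarrow> \<not> dependent_set P D)"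

definition active :: "matroid \<Rightarrow> nat set \<Rightarrow> nat \<Rightarrow> bool" where
  "active P A e \<longleftrightarrow> e \<in> ground P \<and>
     (\<exists>C. circuit P C \<and> e \<in> C \<and> C \<subseteq> A \<union> {e} \<and> e = Min C)"

definition Ext :: "matroid \<Rightarrow> nat set \<Rightarrow> nat set" where
  "Ext P A = {e. active P A e \<and> e \<notin> A}"

text \<open>A poset is given by its carrier and the set of pairs \<open>(A, B)\<close> with \<open>A \<le> B\<close>.\<close>

type_synonym set_poset = "nat set set \<times> (nat set \<times> nat set) set"

definition ext_poset :: "matroid \<Rightarrow> set_poset" where
  "ext_poset P = (bases P, {(A, B). A \<in> bases P \<and> B \<in> bases P \<and> A \<subseteq> B \<union> Ext P B})"

section \<open>The trivial unit interval positroid\<close>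

text \<open>
  Columns are labelled from 1, whereas \<open>col\<close> and \<open>mat\<close> count from 0. A family of columns
  with repeated entries is dependent even if the underlying set of vectors is not, whence the
  injectivity requirement.
\<close>

definition columns_indep :: "real mat \<Rightarrow> nat set \<Rightarrow> bool" where
  "columns_indep M J \<longleftrightarrow> inj_on (\<lambda>j. col M (j - 1)) J \<and>
     \<not> module.lin_dep class_ring (module_vec TYPE(real) (dim_row M)) ((\<lambda>j. col M (j - 1)) ` J)"

definition column_matroid :: "real mat \<Rightarrow> matroid" where
  "column_matroid M = ({1..dim_col M},
     {J. J \<subseteq> {1..dim_col M} \<and> columns_indep M J \<and>
         (\<forall>K. J \<subset> K \<and> K \<subseteq> {1..dim_col M} \<longrightarrow> \<not> columns_indep M K)})"

text \<open>In the 0-based row \<open>i\<close>, the sign \<open>(-1)^(m - (i + 1))\<close> is that of the 1-based row \<open>i + 1\<close>.\<close>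

definition trivial_uip_matrix :: "nat \<Rightarrow> real mat" where
  "trivial_uip_matrix m = mat m (2 * m)
     (\<lambda>(i, j). if j < m then (if i = j then 1 else 0) else (- 1) ^ (m - (i + 1)))"

definition trivial_uip :: "nat \<Rightarrow> matroid" where
  "trivial_uip m = column_matroid (trivial_uip_matrix m)"

section \<open>The algorithm gamma\<close>

definition reinforce :: "nat set \<Rightarrow> nat set" where
  "reinforce B = Suc ` B \<union> {Min B}"

definition build_up :: "nat \<Rightarrow> nat set \<Rightarrow> nat set" where
  "build_up n B = (B - {2 * n + 1}) \<union> {2 * n + 2}"

definition grow_spine :: "nat set \<Rightarrow> nat set" where
  "grow_spine B = (B - {2}) \<union> {1}"

text \<open>\<open>transport f D R\<close> orders the copies \<open>f B\<close> of the sets \<open>B\<close> in \<open>D\<close> as \<open>R\<close> orders these sets.\<close>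

definition transport ::
    "(nat set \<Rightarrow> nat set) \<Rightarrow> nat set set \<Rightarrow> (nat set \<times> nat set) set \<Rightarrow> (nat set \<times> nat set) set"
  where "transport f D R = {(f A, f B) | A B. A \<in> D \<and> B \<in> D \<and> (A, B) \<in> R}"

text \<open>
  Two conventions are needed for \<open>gamma\<close> to yield the bases and the external order of the next
  positroid. First, replacing 2 by 1 is only carried out in sets not containing 1; otherwise the
  result would lose an element, as \<open>{1, 2}\<close> would become \<open>{1}\<close>. Second, the sets formed in each of
  the three steps are ordered among themselves as the sets they are formed from; the cover
  relations alone would leave, for \<open>n = 1\<close>, the sets \<open>{1, 3}\<close> and \<open>{1, 4}\<close> incomparable.
\<close>

definition gamma :: "nat \<Rightarrow> set_poset \<Rightarrow> set_poset" where
  "gamma n Q = (let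
       S\<^sub>1 = reinforce ` fst Q;
       R\<^sub>1 = transport reinforce (fst Q) (snd Q);
       D\<^sub>2 = {B \<in> S\<^sub>1. 2 * n + 1 \<in> B};
       S\<^sub>2 = S\<^sub>1 \<union> build_up n ` D\<^sub>2;
       R\<^sub>2 = R\<^sub>1 \<union> {(B, build_up n B) | B. B \<in> D\<^sub>2} \<union> transport (build_up n) D\<^sub>2 R\<^sub>1;
       D\<^sub>3 = {B \<in> S\<^sub>2. 2 \<in> B \<and> 1 \<notin> B};
       S\<^sub>3 = S\<^sub>2 \<union> grow_spine ` D\<^sub>3;
       R\<^sub>3 = R\<^sub>2 \<union> {(grow_spine B, B) | B. B \<in> D\<^sub>3} \<union> transport grow_spine D\<^sub>3 R\<^sub>2
     in (S\<^sub>3, R\<^sub>3\<^sup>* \<inter> (S\<^sub>3 \<times> S\<^sub>3)))"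

end

theory Submission
  imports Defs
begin

text \<open>
  In \<open>\<P>\<^sub>m\<close> the columns above \<open>m\<close> are parallel and have no zero entry, so the bases are \<open>[m]\<close> and
  the sets \<open>[m] - {i} \<union> {t}\<close> with \<open>i \<le> m < t\<close>, and the circuits are the pairs of parallel columns
  and the sets \<open>[m] \<union> {t}\<close>. Hence \<open>[m] - {i} \<union> {t}\<close> lies below \<open>[m] - {k} \<union> {u}\<close> iff \<open>t \<le> u\<close> and
  \<open>k \<in> {i, 1}\<close>, and \<open>[m]\<close> lies below itself and exactly those with \<open>k = 1\<close>: a spine (\<open>k = 1\<close>) with a
  parallel chain attached for each other \<open>k\<close>. Reinforcing embeds this poset for \<open>m = n\<close> into that
  for \<open>m = n + 1\<close>, missing the chain \<open>k = 2\<close> and the sets with \<open>t = 2n + 2\<close>; building up adds the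
  latter, and growing the spine adds the former as a copy of the chain \<open>k = 1\<close>.
\<close>

section \<open>Independent sets of columns\<close>

text \<open>With coefficients attached to labels instead of vectors, injectivity needs no separate
  mention: two labels with equal columns already give a nontrivial relation. Independence becomes a
  statement about row sums.\<close>

lemma columns_indep_iff:
  assumes J: "J \<subseteq> {1..dim_col M}"
  shows "columns_indep M J \<longleftrightarrow>
    (\<forall>c. (\<forall>i<dim_row M. (\<Sum>j\<in>J. c j * M $$ (i, j - 1)) = 0) \<longrightarrow> (\<forall>j\<in>J. c j = 0))"
    (is "_ \<longleftrightarrow> ?R")
proof -
  interpret vec_space "TYPE(real)" "dim_row M" .
  let ?v = "\<lambda>j. col M (j - 1)"
  have fin: "finite J" using J finite_subset by blast
  have carr: "?v ` J \<subseteq> carrier_vec (dim_row M)" by auto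
  have entry: "?v j $ i = M $$ (i, j - 1)" if "j \<in> J" "i < dim_row M" for i j
    using that J by (subst index_col) (auto simp: subset_iff)
  have comb: "lincomb a (?v ` J) $ i = (\<Sum>j\<in>J. a (?v j) * M $$ (i, j - 1))"
    if "inj_on ?v J" "i < dim_row M" for a i
    unfolding lincomb_index[OF that(2) carr] sum.reindex[OF that(1)] o_def
    by (rule sum.cong) (use entry that in simp_all)
  show ?thesis
  proof
    assume ind: "columns_indep M J"
    then have inj: "inj_on ?v J" and li: "lin_indpt (?v ` J)"
      by (auto simp: columns_indep_def)
    show ?R
    proof (intro allI impI)
      fix c assume c: "\<forall>i<dim_row M. (\<Sum>j\<in>J. c j * M $$ (i, j - 1)) = 0"
      \<comment> \<open>\<open>lincomb\<close> expects coefficients on vectors while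
        \<open>c\<close> lives on labels; injectivity allows the transfer.\<close>
      define a where "a = c \<circ> inv_into J ?v"
      have ac: "a (?v j) = c j" if "j \<in> J" for j
        using inv_into_f_f[OF inj that] by (simp add: a_def)
      have "lincomb a (?v ` J) = 0\<^sub>v (dim_row M)"
      proof (rule eq_vecI)
        fix i assume "i < dim_vec (0\<^sub>v (dim_row M) :: real vec)"
        then show "lincomb a (?v ` J) $ i = 0\<^sub>v (dim_row M) $ i"
          using comb[OF inj, of i a] c ac by simp
      qed (use lincomb_dim[OF finite_imageI[OF fin] carr] in simp)
      then have "\<forall>v\<in>?v ` J. a v = 0"
        using li fin carr not_lindepD[OF li _ subset_refl] by auto
      then show "\<forall>j\<in>J. c j = 0" using ac by auto
    qed
  next
    assume R: ?R
    have inj: "inj_on ?v J"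
    proof (rule inj_onI, rule ccontr)
      fix j k assume jk: "j \<in> J" "k \<in> J" "?v j = ?v k" "j \<noteq> k"
      \<comment> \<open>The relation expressing that columns \<open>j\<close> and \<open>k\<close>
        coincide.\<close>
      define c :: "nat \<Rightarrow> real" where "c x = (if x = j then 1 else if x = k then -1 else 0)" for x
      have "(\<Sum>x\<in>J. c x * M $$ (i, x - 1)) = 0" if i: "i < dim_row M" for i
      proof -
        have "(\<Sum>x\<in>J. c x * M $$ (i, x - 1)) = (\<Sum>x\<in>{j, k}. c x * M $$ (i, x - 1))"
          by (rule sum.mono_neutral_right) (use jk fin in \<open>auto simp: c_def\<close>)
        also have "\<dots> = 0"
          using jk entry[OF jk(1) i] entry[OF jk(2) i] by (simp add: c_def)
        finally show ?thesis .
      qed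
      then have "c j = 0" using R jk(1) by blast
      then show False by (simp add: c_def)
    qed
    have "\<forall>v\<in>?v ` J. a v = 0" if "lincomb a (?v ` J) = 0\<^sub>v (dim_row M)" for a
    proof -
      have "(\<Sum>j\<in>J. a (?v j) * M $$ (i, j - 1)) = 0" if i: "i < dim_row M" for i
        using comb[OF inj i, of a] \<open>lincomb a (?v ` J) = 0\<^sub>v (dim_row M)\<close> i by simp
      then have "\<forall>j\<in>J. a (?v j) = 0" using R[rule_format, of "\<lambda>j. a (?v j)"] by blast
      then show ?thesis by simp
    qed
    then have "lin_indpt (?v ` J)"
      by (intro finite_lin_indpt2) (use fin carr in \<open>simp_all add: class_ring_simps\<close>)
    with inj show "columns_indep M J" by (simp add: columns_indep_def)
  qed
qed

text \<open>Row \<open>i\<close> meets a single identity column, the one labelled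
  \<open>Suc i\<close>, and all columns above \<open>m\<close> with the same entry. So the
  coefficients above \<open>m\<close> enter only through their sum.\<close>

lemma row_sum_trivial_uip_matrix:
  assumes J: "J \<subseteq> {1..2 * m}" and i: "i < m"
  shows "(\<Sum>j\<in>J. c j * trivial_uip_matrix m $$ (i, j - 1)) =
    (if Suc i \<in> J then c (Suc i) else 0) + (- 1) ^ (m - (i + 1)) * (\<Sum>j\<in>J \<inter> {m<..}. c j)"
proof -
  have fin: "finite J" using J finite_subset by blast
  have "(\<Sum>j\<in>J. c j * trivial_uip_matrix m $$ (i, j - 1)) =
    (\<Sum>j\<in>J. (if j = Suc i then c j else 0) +
      (if j \<in> {m<..} then (- 1) ^ (m - (i + 1)) * c j else 0))"
    by (rule sum.cong) (use J i in \<open>auto simp: trivial_uip_matrix_def subset_iff\<close>)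
  also have "\<dots> = (\<Sum>j\<in>J. if j = Suc i then c j else 0) +
      (\<Sum>j\<in>J. if j \<in> {m<..} then (- 1) ^ (m - (i + 1)) * c j else 0)"
    by (rule sum.distrib)
  also have "(\<Sum>j\<in>J. if j = Suc i then c j else 0) = (if Suc i \<in> J then c (Suc i) else 0)"
    using fin by (simp add: sum.delta')
  also have "(\<Sum>j\<in>J. if j \<in> {m<..} then (- 1) ^ (m - (i + 1)) * c j else 0) =
      (\<Sum>j\<in>J \<inter> {m<..}. (- 1) ^ (m - (i + 1)) * c j)"
    by (rule sum.inter_restrict[OF fin, symmetric])
  finally show ?thesis by (simp add: sum_distrib_left)
qed

text \<open>Two columns above \<open>m\<close> are equal and cancel, and one of them is a
  combination of all the identity columns. If an identity column is missing, its row forces the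
  single coefficient above \<open>m\<close> to be 0, and the other rows then kill the rest.\<close>

lemma columns_indep_trivial_uip_matrix:
  assumes J: "J \<subseteq> {1..2 * m}"
  shows "columns_indep (trivial_uip_matrix m) J \<longleftrightarrow>
    J \<subseteq> {1..m} \<or> (\<exists>t. J \<inter> {m<..} = {t} \<and> \<not> {1..m} \<subseteq> J)"
proof -
  have dims: "dim_row (trivial_uip_matrix m) = m" "dim_col (trivial_uip_matrix m) = 2 * m"
    by (simp_all add: trivial_uip_matrix_def)
  have fin: "finite J" using J finite_subset by blast
  let ?row = "\<lambda>c i. (if Suc i \<in> J then c (Suc i) else 0) +
    (- 1) ^ (m - (i + 1)) * (\<Sum>j\<in>J \<inter> {m<..}. c j)"
  have iff: "columns_indep (trivial_uip_matrix m) J \<longleftrightarrow>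
    (\<forall>c. (\<forall>i<m. ?row c i = (0::real)) \<longrightarrow> (\<forall>j\<in>J. c j = 0))"
  proof -
    have "(\<forall>i<m. (\<Sum>j\<in>J. c j * trivial_uip_matrix m $$ (i, j - 1)) = 0) \<longleftrightarrow> (\<forall>i<m. ?row c i = 0)"
      for c
      by (rule all_cong) (simp only: row_sum_trivial_uip_matrix[OF J])
    then show ?thesis
      using columns_indep_iff[of J "trivial_uip_matrix m", unfolded dims, OF J] by (simp only:)
  qed
  show ?thesis
  proof
    assume ind: "columns_indep (trivial_uip_matrix m) J"
    show "J \<subseteq> {1..m} \<or> (\<exists>t. J \<inter> {m<..} = {t} \<and> \<not> {1..m} \<subseteq> J)"
    proof (cases "J \<subseteq> {1..m}")
      case False
      then obtain t where t: "t \<in> J" "t > m" using J by fastforce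
      have single: "u = t" if u: "u \<in> J" "u > m" for u
      proof (rule ccontr)
        assume "u \<noteq> t"
        define c :: "nat \<Rightarrow> real" where "c x = (if x = t then 1 else if x = u then -1 else 0)" for x
        have "(\<Sum>j\<in>J \<inter> {m<..}. c j) = (\<Sum>j\<in>{t, u}. c j)"
          by (rule sum.mono_neutral_right) (use t u fin in \<open>auto simp: c_def\<close>)
        also have "\<dots> = 0" using \<open>u \<noteq> t\<close> by (simp add: c_def)
        finally have sum0: "(\<Sum>j\<in>J \<inter> {m<..}. c j) = 0" .
        have "c (Suc i) = 0" if "i < m" for i using that t u by (simp add: c_def)
        then have "\<forall>i<m. ?row c i = 0" by (simp only: sum0) simp
        then have "c t = 0" using ind iff t by blast
        then show False by (simp add: c_def)
      qed
      then have top: "J \<inter> {m<..} = {t}"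
        by (intro equalityI subsetI) (auto dest: single simp: t)
      have "\<not> {1..m} \<subseteq> J"
      proof
        assume all: "{1..m} \<subseteq> J"
        \<comment> \<open>The identity column \<open>x\<close> gets minus the entry of column
          \<open>t\<close> in the 1-based row \<open>x\<close>, so every row cancels.\<close>
        define c :: "nat \<Rightarrow> real" where "c x = (if x = t then 1 else - ((- 1) ^ (m - x)))" for x
        have "?row c i = 0" if "i < m" for i
        proof -
          have "Suc i \<in> J" "Suc i \<noteq> t" using that all t by auto
          then show ?thesis by (simp add: top c_def)
        qed
        then have "c t = 0" using ind iff t by blast
        then show False by (simp add: c_def)
      qed
      with top show ?thesis by blast
    qed simp
  next
    assume I: "J \<subseteq> {1..m} \<or> (\<exists>t. J \<inter> {m<..} = {t} \<and> \<not> {1..m} \<subseteq> J)"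
    show "columns_indep (trivial_uip_matrix m) J"
      unfolding iff
    proof (intro allI impI ballI)
      fix c :: "nat \<Rightarrow> real" and j
      assume z: "\<forall>i<m. ?row c i = 0" and j: "j \<in> J"
      \<comment> \<open>The row of a missing identity column contains nothing but this sum; for
        \<open>J\<close> inside \<open>{1..m}\<close> the sum is empty.\<close>
      have top: "(\<Sum>j\<in>J \<inter> {m<..}. c j) = 0"
        using I
      proof
        assume "\<exists>t. J \<inter> {m<..} = {t} \<and> \<not> {1..m} \<subseteq> J"
        then obtain k where "k \<in> {1..m}" "k \<notin> J" by blast
        then obtain i where i: "Suc i \<notin> J" "i < m" by (cases k) auto
        have "?row c i = 0" using z i(2) by blast
        then show ?thesis using i(1) by simp
      next
        assume "J \<subseteq> {1..m}"
        then have "J \<inter> {m<..} = {}" by auto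
        then show ?thesis by simp
      qed
      show "c j = 0"
      proof (cases "j \<le> m")
        case True
        then obtain i where i: "j = Suc i" "i < m" using j J by (cases j) auto
        show ?thesis using z[rule_format, OF i(2)] j unfolding top i(1) by simp
      next
        case False
        then have jm: "j \<in> J \<inter> {m<..}" using j by simp
        with I obtain t where t: "J \<inter> {m<..} = {t}" by fastforce
        have "j = t" using jm unfolding t by simp
        then show ?thesis using top unfolding t by simp
      qed
    qed
  qed
qed

section \<open>Bases, circuits and external order\<close>

text \<open>For \<open>i\<close> in \<open>{1..m}\<close> and \<open>t > m\<close> this is the basis
  \<open>{1..m}\<close> with \<open>i\<close> exchanged for \<open>t\<close>. The index
  \<open>i\<close> selects a chain of the poset and \<open>t\<close> is the height in that
  chain.\<close>

definition exch :: "nat \<Rightarrow> nat \<Rightarrow> nat \<Rightarrow> nat set" where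
  "exch m i t = insert t ({1..m} - {i})"

text \<open>The parameters can be read off: \<open>i\<close> is the one element of
  \<open>{1..m}\<close> that is absent, \<open>t\<close> the one element above
  \<open>m\<close>.\<close>

lemma exch_eq_iff:
  assumes "i \<in> {1..m}" "k \<in> {1..m}" "m < t" "m < u"
  shows "exch m i t = exch m k u \<longleftrightarrow> i = k \<and> t = u"
proof
  assume eq: "exch m i t = exch m k u"
  have "i \<notin> exch m k u" "t \<in> exch m k u"
    using assms unfolding eq[symmetric] by (auto simp: exch_def)
  then show "i = k \<and> t = u" using assms by (auto simp: exch_def)
qed simp

lemma exch_neq_interval: "m < t \<Longrightarrow> exch m i t \<noteq> {1..m}"
  by (metis atLeastAtMost_iff exch_def insertI1 leD)

lemma ground_trivial_uip: "ground (trivial_uip m) = {1..2 * m}"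
  by (simp add: trivial_uip_def column_matroid_def trivial_uip_matrix_def)

text \<open>An independent set with an element \<open>t\<close> above \<open>m\<close> misses some
  \<open>i\<close> in \<open>{1..m}\<close>, hence lies in \<open>exch m i t\<close>. Enlarging that
  set brings in either \<open>i\<close>, completing \<open>{1..m}\<close>, or a second element above
  \<open>m\<close>; both destroy independence.\<close>

lemma bases_trivial_uip:
  "bases (trivial_uip m) = {{1..m}} \<union> {exch m i t | i t. i \<in> {1..m} \<and> t \<in> {m<..2 * m}}"
  (is "_ = ?E")
proof -
  let ?I = "\<lambda>J. J \<subseteq> {1..m} \<or> (\<exists>t. J \<inter> {m<..} = {t} \<and> \<not> {1..m} \<subseteq> J)"
  have basis_iff: "B \<in> bases (trivial_uip m) \<longleftrightarrow> B \<subseteq> {1..2 * m} \<and> ?I B \<and>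
    (\<forall>K. B \<subset> K \<and> K \<subseteq> {1..2 * m} \<longrightarrow> \<not> ?I K)" for B
  proof -
    have "dim_col (trivial_uip_matrix m) = 2 * m" by (simp add: trivial_uip_matrix_def)
    then have "B \<in> bases (trivial_uip m) \<longleftrightarrow> B \<subseteq> {1..2 * m} \<and>
      columns_indep (trivial_uip_matrix m) B \<and>
      (\<forall>K. B \<subset> K \<and> K \<subseteq> {1..2 * m} \<longrightarrow> \<not> columns_indep (trivial_uip_matrix m) K)"
      unfolding trivial_uip_def column_matroid_def by (simp only: snd_conv mem_Collect_eq)
    also have "\<dots> \<longleftrightarrow> B \<subseteq> {1..2 * m} \<and> ?I B \<and> (\<forall>K. B \<subset> K \<and> K \<subseteq> {1..2 * m} \<longrightarrow> \<not> ?I K)"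
      by (intro conj_cong all_cong refl arg_cong[of _ _ Not] columns_indep_trivial_uip_matrix) simp_all
    finally show ?thesis .
  qed
  show ?thesis
  proof (intro Set.set_eqI iffI)
    fix B assume "B \<in> bases (trivial_uip m)"
    then have sub: "B \<subseteq> {1..2 * m}" and I: "?I B"
      and max: "\<And>K. B \<subset> K \<Longrightarrow> K \<subseteq> {1..2 * m} \<Longrightarrow> \<not> ?I K"
      unfolding basis_iff by blast+
    from I show "B \<in> ?E"
    proof
      assume "B \<subseteq> {1..m}"
      with max[of "{1..m}"] have "B = {1..m}" by auto
      then show ?thesis by simp
    next
      assume "\<exists>t. B \<inter> {m<..} = {t} \<and> \<not> {1..m} \<subseteq> B"
      then obtain t i where t: "B \<inter> {m<..} = {t}" and i: "i \<in> {1..m}" "i \<notin> B" by blast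
      have tt: "t \<in> {m<..2 * m}" using t sub by auto
      have "x \<in> exch m i t" if x: "x \<in> B" for x
      proof (cases "x \<le> m")
        case True
        then show ?thesis using x sub i by (auto simp: exch_def subset_iff)
      next
        case False
        then have "x \<in> B \<inter> {m<..}" using x by simp
        then show ?thesis using t by (simp add: exch_def)
      qed
      then have "B \<subseteq> exch m i t" by blast
      moreover have "exch m i t \<subseteq> {1..2 * m}" using tt by (auto simp: exch_def)
      moreover have "exch m i t \<inter> {m<..} = {t}" "\<not> {1..m} \<subseteq> exch m i t"
        using tt i by (auto simp: exch_def)
      ultimately have "B = exch m i t" using max[of "exch m i t"] by blast
      with i tt show ?thesis by blast
    qed
  next
    fix B assume "B \<in> ?E"
    then consider "B = {1..m}" | i t where "i \<in> {1..m}" "t \<in> {m<..2 * m}" "B = exch m i t"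
      by blast
    then show "B \<in> bases (trivial_uip m)"
    proof cases
      case 1
      then show ?thesis unfolding basis_iff by auto
    next
      case 2
      have I: "B \<inter> {m<..} = {t}" "\<not> {1..m} \<subseteq> B" "B \<subseteq> {1..2 * m}"
        using 2 by (auto simp: exch_def)
      have notI: "\<not> ?I K" if K: "B \<subset> K" "K \<subseteq> {1..2 * m}" for K
      proof
        assume IK: "?I K"
        have "t \<in> K" "t > m" using I(1) K(1) by auto
        then obtain s where s: "K \<inter> {m<..} = {s}" and nK: "\<not> {1..m} \<subseteq> K"
          using IK by fastforce
        have "t \<in> K \<inter> {m<..}" using \<open>t \<in> K\<close> \<open>t > m\<close> by simp
        then have st: "s = t" unfolding s by simp
        from K(1) obtain x where x: "x \<in> K" "x \<notin> B" by blast
        have "\<not> x > m"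
        proof
          assume "x > m"
          then have "x \<in> K \<inter> {m<..}" using x by simp
          then have "x \<in> B" using I(1) unfolding s st by blast
          with x show False by simp
        qed
        \<comment> \<open>A new element that is not above \<open>m\<close> can only be the exchanged
          one.\<close>
        then have "x = i" using x K(2) 2 by (auto simp: exch_def subset_iff)
        then have "{1..m} \<subseteq> K" using x K(1) 2 by (auto simp: exch_def)
        with nK show False ..
      qed
      from I(1,2) have IB: "?I B" by (intro disjI2 exI[of _ t] conjI)
      show ?thesis
        unfolding basis_iff
      proof (intro conjI allI impI)
        fix K assume "B \<subset> K \<and> K \<subseteq> {1..2 * m}"
        then show "\<not> ?I K" using notI by simp
      qed (fact I(3) IB)+
    qed
  qed
qed

section \<open>Dependent sets and circuits\<close>

lemma dependent_set_trivial_uip: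
  "dependent_set (trivial_uip m) X \<longleftrightarrow> X \<subseteq> {1..2 * m} \<and>
    ((\<exists>t u. t \<in> X \<and> u \<in> X \<and> m < t \<and> t < u) \<or> (\<exists>t\<in>X. m < t \<and> {1..m} \<subseteq> X))"
proof (cases "X \<subseteq> {1..2 * m}")
  case X: True
  have "(\<exists>B\<in>bases (trivial_uip m). X \<subseteq> B) \<longleftrightarrow>
    X \<subseteq> {1..m} \<or> (\<exists>i\<in>{1..m}. \<exists>t\<in>{m<..2 * m}. X \<subseteq> exch m i t)"
    unfolding bases_trivial_uip by blast
  also have "\<dots> \<longleftrightarrow> \<not> ((\<exists>t u. t \<in> X \<and> u \<in> X \<and> m < t \<and> t < u) \<or> (\<exists>t\<in>X. m < t \<and> {1..m} \<subseteq> X))"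
    (is "?L \<longleftrightarrow> \<not> ?D")
  proof
    assume ?L
    then show "\<not> ?D"
    proof
      assume "X \<subseteq> {1..m}"
      then show ?thesis by fastforce
    next
      assume "\<exists>i\<in>{1..m}. \<exists>t\<in>{m<..2 * m}. X \<subseteq> exch m i t"
      then obtain i t where it: "i \<in> {1..m}" "t \<in> {m<..2 * m}" "X \<subseteq> exch m i t" by blast
      then have "i \<notin> X" and "\<And>x. x \<in> X \<Longrightarrow> m < x \<Longrightarrow> x = t" by (auto simp: exch_def)
      with it(1) show ?thesis by (metis less_irrefl less_trans subsetD)
    qed
  next
    assume nD: "\<not> ?D"
    show ?L
    proof (cases "X \<subseteq> {1..m}")
      case False
      then obtain t where t: "t \<in> X" "m < t" using X by fastforce
      with nD obtain i where i: "i \<in> {1..m}" "i \<notin> X" by blast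
      have "x \<in> exch m i t" if "x \<in> X" for x
      proof (cases "m < x")
        case True
        then have "x = t" using nD t that by (metis linorder_neqE_nat)
        then show ?thesis by (simp add: exch_def)
      next
        case False
        then show ?thesis using that i X by (auto simp: exch_def subset_iff)
      qed
      then have "X \<subseteq> exch m i t" by blast
      then show ?thesis using t i X by auto
    qed simp
  qed
  finally show ?thesis using X by (auto simp: dependent_set_def ground_trivial_uip)
qed (simp add: dependent_set_def ground_trivial_uip)

text \<open>These are the minimal witnesses for the two causes of dependence. Neither kind contains
  the other: a pair above \<open>m\<close> avoids \<open>{1..m}\<close>, and
  \<open>insert t {1..m}\<close> has only one element above \<open>m\<close>.\<close>

lemma circuit_trivial_uip:
  "circuit (trivial_uip m) C \<longleftrightarrow>
    (\<exists>t u. m < t \<and> t < u \<and> u \<le> 2 * m \<and> C = {t, u}) \<or> (\<exists>t\<in>{m<..2 * m}. C = insert t {1..m})"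
    (is "_ \<longleftrightarrow> ?R")
proof
  assume "circuit (trivial_uip m) C"
  then have dep: "dependent_set (trivial_uip m) C"
    and min: "\<And>D. dependent_set (trivial_uip m) D \<Longrightarrow> D \<subseteq> C \<Longrightarrow> D = C"
    unfolding circuit_def by blast+
  from dep have sub: "C \<subseteq> {1..2 * m}" by (simp add: dependent_set_trivial_uip)
  from dep consider t u where "t \<in> C" "u \<in> C" "m < t" "t < u" | t where "t \<in> C" "m < t" "{1..m} \<subseteq> C"
    unfolding dependent_set_trivial_uip by blast
  then show ?R
  proof cases
    case 1
    then have "{t, u} = C"
      by (intro min) (use sub in \<open>auto simp: dependent_set_trivial_uip\<close>)
    moreover from this have "u \<le> 2 * m" using sub by auto
    ultimately show ?thesis using 1(3,4) by blast
  next
    case 2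
    then have "insert t {1..m} = C"
      by (intro min) (use sub in \<open>auto simp: dependent_set_trivial_uip\<close>)
    with 2 sub show ?thesis by auto
  qed
next
  assume ?R
  then consider t u where "m < t" "t < u" "u \<le> 2 * m" "C = {t, u}"
    | t where "t \<in> {m<..2 * m}" "C = insert t {1..m}" by blast
  then show "circuit (trivial_uip m) C"
  proof cases
    case 1
    \<comment> \<open>From \<open>m < t\<close> and \<open>u \<le> 2 * m\<close> follows
      \<open>m \<ge> 1\<close>, so 1 lies in \<open>{1..m}\<close> but not in
      \<open>C\<close>.\<close>
    then have ne: "\<not> {1..m} \<subseteq> D" if "D \<subseteq> C" for D
      using that by (auto simp: subset_iff dest!: spec[of _ 1])
    have "\<not> dependent_set (trivial_uip m) D" if D: "D \<subset> C" for D
    proof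
      assume "dependent_set (trivial_uip m) D"
      with ne D obtain a b where ab: "a \<in> D" "b \<in> D" "a < b"
        unfolding dependent_set_trivial_uip by blast
      then have "a = t" "b = u" using D 1 by auto
      with ab D 1 show False by auto
    qed
    moreover have "dependent_set (trivial_uip m) C"
      using 1 unfolding dependent_set_trivial_uip by auto
    ultimately show ?thesis unfolding circuit_def by blast
  next
    case 2
    then have top: "x = t" if "x \<in> C" "m < x" for x using that by auto
    have "\<not> dependent_set (trivial_uip m) D" if D: "D \<subset> C" for D
    proof
      assume "dependent_set (trivial_uip m) D"
      then consider a b where "a \<in> D" "b \<in> D" "m < a" "a < b"
        | a where "a \<in> D" "m < a" "{1..m} \<subseteq> D"
        unfolding dependent_set_trivial_uip by blast
      then show False
      proof cases
        case (1 a b)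
        with D top[of a] top[of b] show False by auto
      next
        case (2 a)
        with D top[of a] have "t \<in> D" by auto
        with 2 \<open>C = insert t {1..m}\<close> D show False by auto
      qed
    qed
    moreover have "dependent_set (trivial_uip m) C"
      using 2 unfolding dependent_set_trivial_uip by auto
    ultimately show ?thesis unfolding circuit_def by blast
  qed
qed

section \<open>Externally active elements\<close>

lemma Ext_interval:
  assumes "m \<ge> 1"
  shows "Ext (trivial_uip m) {1..m} = {}"
proof -
  have False if act: "active (trivial_uip m) {1..m} e" and e: "e \<notin> {1..m}" for e
  proof -
    from act obtain C where C: "circuit (trivial_uip m) C" "e \<in> C" "C \<subseteq> insert e {1..m}" "e = Min C"
      by (auto simp: active_def)
    \<comment> \<open>A pair above \<open>m\<close> does not fit into
      \<open>insert e {1..m}\<close>, so \<open>C\<close> is of the large kind and its minimum is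
      too small to be \<open>e\<close>.\<close>
    from C(1) have "{1..m} \<subseteq> C" "finite C"
      using C(3) unfolding circuit_trivial_uip by auto
    then have "Min C \<le> 1" using assms by (intro Min_le) auto
    moreover have "e \<in> {1..2 * m}" using act by (simp add: active_def ground_trivial_uip)
    ultimately show False using C(4) e assms by auto
  qed
  then show ?thesis by (auto simp: Ext_def)
qed

text \<open>Adding \<open>e > m\<close> closes the pair \<open>{e, t}\<close>, whose minimum is
  \<open>e\<close> just for \<open>e < t\<close>. Adding \<open>i\<close> closes
  \<open>insert t {1..m}\<close>, whose minimum is 1, so \<open>i\<close> is active only if it
  equals 1.\<close>

lemma Ext_exch:
  assumes i: "i \<in> {1..m}" and t: "t \<in> {m<..2 * m}"
  shows "Ext (trivial_uip m) (exch m i t) = {m<..<t} \<union> (if i = 1 then {1} else {})"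
proof (intro Set.set_eqI iffI)
  fix e assume "e \<in> Ext (trivial_uip m) (exch m i t)"
  then obtain C where C: "circuit (trivial_uip m) C" "e \<in> C" "C \<subseteq> insert e (exch m i t)" "e = Min C"
    and e: "e \<notin> exch m i t"
    by (auto simp: Ext_def active_def)
  from C(1) consider s u where "m < s" "s < u" "C = {s, u}" | u where "u \<in> {m<..2 * m}" "C = insert u {1..m}"
    unfolding circuit_trivial_uip by blast
  then show "e \<in> {m<..<t} \<union> (if i = 1 then {1} else {})"
  proof cases
    case 1
    then have "e = s" using C(4) by simp
    moreover from this have "u = t" using 1 C(3) by (auto simp: exch_def)
    ultimately show ?thesis using 1 by simp
  next
    case 2
    then have "i \<in> insert e (exch m i t)" using C(3) i by blast
    then have "e = i" using i t by (auto simp: exch_def)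
    moreover have "Min C \<le> 1" using 2 i by (intro Min_le) auto
    ultimately show ?thesis using C(4) i by auto
  qed
next
  fix e assume "e \<in> {m<..<t} \<union> (if i = 1 then {1} else {})"
  then consider "m < e" "e < t" | "e = 1" "i = 1" by (auto split: if_splits)
  then show "e \<in> Ext (trivial_uip m) (exch m i t)"
  proof cases
    case 1
    then have "circuit (trivial_uip m) {e, t}" using t by (auto simp: circuit_trivial_uip)
    moreover have "Min {e, t} = e" using 1 by simp
    ultimately have "active (trivial_uip m) (exch m i t) e"
      using 1 t unfolding active_def ground_trivial_uip
      by (intro conjI exI[of _ "{e, t}"]) (auto simp: exch_def)
    then show ?thesis using 1 by (simp add: Ext_def exch_def)
  next
    case 2
    have "circuit (trivial_uip m) (insert t {1..m})" using t by (auto simp: circuit_trivial_uip)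
    moreover have "Min (insert t {1..m}) = 1" by (rule Min_eqI) (use i t in auto)
    ultimately have "active (trivial_uip m) (exch m i t) e"
      using 2 t i unfolding active_def ground_trivial_uip
      by (intro conjI exI[of _ "insert t {1..m}"]) (auto simp: exch_def)
    then show ?thesis using 2 t i by (simp add: Ext_def exch_def)
  qed
qed

text \<open>Explicit form of the external order. The chains present (\<open>I\<close>) and the
  greatest height (\<open>v\<close>) are kept variable because the order obtained by reinforcing has
  the same shape with one chain and one height fewer.\<close>

inductive_set exch_order :: "nat \<Rightarrow> nat set \<Rightarrow> nat \<Rightarrow> (nat set \<times> nat set) set"
  for m I v
  where
    interval: "({1..m}, {1..m}) \<in> exch_order m I v"
  | interval_exch: "m < u \<Longrightarrow> u \<le> v \<Longrightarrow> ({1..m}, exch m 1 u) \<in> exch_order m I v"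
  | exch_exch: "i \<in> I \<Longrightarrow> k = i \<or> k = 1 \<Longrightarrow> m < t \<Longrightarrow> t \<le> u \<Longrightarrow> u \<le> v \<Longrightarrow>
      (exch m i t, exch m k u) \<in> exch_order m I v"

lemma exch_order_mono: "I \<subseteq> I' \<Longrightarrow> v \<le> v' \<Longrightarrow> exch_order m I v \<subseteq> exch_order m I' v'"
  by (auto elim!: exch_order.cases intro!: exch_order.intros)

text \<open>The set in the middle determines its parameters by \<open>exch_eq_iff\<close>, and the
  conditions \<open>t \<le> u\<close> and \<open>k = i \<or> k = 1\<close> both compose. The
  assumptions keep all indices in \<open>{1..m}\<close>, where \<open>exch_eq_iff\<close>
  applies.\<close>

lemma trans_exch_order:
  assumes I: "I \<subseteq> {1..m}" and m: "m \<ge> 1"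
  shows "trans (exch_order m I v)"
proof (rule transI)
  fix A B C
  assume AB: "(A, B) \<in> exch_order m I v" and BC: "(B, C) \<in> exch_order m I v"
  from BC show "(A, C) \<in> exch_order m I v"
  proof cases
    case interval
    with AB show ?thesis by simp
  next
    case (interval_exch u)
    from AB show ?thesis
    proof cases
      case interval
      with BC show ?thesis by simp
    next
      case (interval_exch u')
      with \<open>B = {1..m}\<close> exch_neq_interval show ?thesis by metis
    next
      case (exch_exch i k t u')
      then have "m < u'" by simp
      with \<open>B = exch m k u'\<close> \<open>B = {1..m}\<close> exch_neq_interval show ?thesis by metis
    qed
  next
    case BC': (exch_exch i k t u)
    from AB show ?thesis
    proof cases
      case interval
      with BC show ?thesis by simp
    next
      case (interval_exch u')
      have "i \<in> {1..m}" "1 \<in> {1..m}" using BC' I m by auto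
      with BC'(1,5) interval_exch(2,3) have "i = 1" "t = u'" using exch_eq_iff by metis+
      then have "k = 1" "m < u" "u \<le> v" using BC' interval_exch by auto
      then have "({1..m}, exch m 1 u) \<in> exch_order m I v" by (intro exch_order.interval_exch)
      then show ?thesis using BC'(2) interval_exch(1) \<open>k = 1\<close> by (simp only:)
    next
      case (exch_exch i' k' t' u')
      have "i \<in> {1..m}" "k' \<in> {1..m}" "m < u'" using BC' exch_exch I m by auto
      with BC'(1,5) exch_exch(2) have "i = k'" "t = u'" using exch_eq_iff by metis+
      with BC' exch_exch show ?thesis by (auto intro!: exch_order.intros)
    qed
  qed
qed

text \<open>The active elements fill the gap between \<open>m\<close> and \<open>u\<close>, and also
  the gap at \<open>k\<close> if \<open>k = 1\<close>. So comparing with \<open>exch m k u\<close>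
  means inclusion in \<open>{1..u}\<close>, with \<open>k\<close> removed unless
  \<open>k = 1\<close>.\<close>

lemma ext_poset_trivial_uip:
  assumes m: "m \<ge> 1"
  shows "ext_poset (trivial_uip m) = (bases (trivial_uip m), exch_order m {1..m} (2 * m))"
proof -
  have low: "A \<subseteq> {1..m} \<union> Ext (trivial_uip m) {1..m} \<longleftrightarrow> A \<subseteq> {1..m}" for A
    unfolding Ext_interval[OF m] by simp
  have no: "\<not> exch m i t \<subseteq> {1..m}" if "m < t" for i t using that by (auto simp: exch_def)
  have cover: "exch m k u \<union> Ext (trivial_uip m) (exch m k u) =
      (if k = 1 then {1..u} else {1..u} - {k})"
    if "k \<in> {1..m}" "u \<in> {m<..2 * m}" for k u
    unfolding Ext_exch[OF that] using that by (auto simp: exch_def)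
  have bot: "{1..m} \<subseteq> exch m k u \<union> Ext (trivial_uip m) (exch m k u) \<longleftrightarrow> k = 1"
    if "k \<in> {1..m}" "u \<in> {m<..2 * m}" for k u
    using that unfolding cover[OF that] by auto
  have ex: "exch m i t \<subseteq> exch m k u \<union> Ext (trivial_uip m) (exch m k u) \<longleftrightarrow>
      (k = i \<or> k = 1) \<and> t \<le> u"
    if "i \<in> {1..m}" "t \<in> {m<..2 * m}" "k \<in> {1..m}" "u \<in> {m<..2 * m}" for i t k u
    using that unfolding cover[OF that(3,4)] by (auto simp: exch_def)
  have "{(A, B). A \<in> bases (trivial_uip m) \<and> B \<in> bases (trivial_uip m) \<and>
      A \<subseteq> B \<union> Ext (trivial_uip m) B} = exch_order m {1..m} (2 * m)"
  proof (intro equalityI subrelI)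
    fix A B
    assume "(A, B) \<in> {(A, B). A \<in> bases (trivial_uip m) \<and> B \<in> bases (trivial_uip m) \<and>
      A \<subseteq> B \<union> Ext (trivial_uip m) B}"
    then have AB: "A \<in> bases (trivial_uip m)" "B \<in> bases (trivial_uip m)"
      "A \<subseteq> B \<union> Ext (trivial_uip m) B" by auto
    from AB(1) consider "A = {1..m}" | i t where "i \<in> {1..m}" "t \<in> {m<..2 * m}" "A = exch m i t"
      unfolding bases_trivial_uip by blast
    note A = this
    from AB(2) consider "B = {1..m}" | k u where "k \<in> {1..m}" "u \<in> {m<..2 * m}" "B = exch m k u"
      unfolding bases_trivial_uip by blast
    then show "(A, B) \<in> exch_order m {1..m} (2 * m)"
    proof cases
      case B: 1
      from A show ?thesis
      proof cases
        case 1 with B show ?thesis by (simp only: exch_order.interval)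
      next
        case (2 i t) with AB(3) B low no show ?thesis by auto
      qed
    next
      case B: (2 k u)
      from A show ?thesis
      proof cases
        case 1
        with AB(3) B bot have "k = 1" by blast
        with 1 B show ?thesis using exch_order.interval_exch by simp
      next
        case (2 i t)
        with AB(3) B ex have "(k = i \<or> k = 1) \<and> t \<le> u" by blast
        with 2 B show ?thesis using exch_order.exch_exch by simp
      qed
    qed
  next
    fix A B assume "(A, B) \<in> exch_order m {1..m} (2 * m)"
    then show "(A, B) \<in> {(A, B). A \<in> bases (trivial_uip m) \<and> B \<in> bases (trivial_uip m) \<and>
      A \<subseteq> B \<union> Ext (trivial_uip m) B}"
    proof cases
      case interval
      then show ?thesis by (auto simp: bases_trivial_uip)
    next
      case (interval_exch u)
      then have r: "u \<in> {m<..2 * m}" "1 \<in> {1..m}" using m by auto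
      then have "A \<subseteq> B \<union> Ext (trivial_uip m) B" using interval_exch bot by blast
      then show ?thesis using interval_exch r unfolding bases_trivial_uip by blast
    next
      case (exch_exch i k t u)
      then have r: "t \<in> {m<..2 * m}" "k \<in> {1..m}" "u \<in> {m<..2 * m}" by auto
      then have "A \<subseteq> B \<union> Ext (trivial_uip m) B" using exch_exch ex by blast
      then show ?thesis using exch_exch r unfolding bases_trivial_uip by blast
    qed
  qed
  then show ?thesis by (simp only: ext_poset_def)
qed

section \<open>The steps of gamma\<close>

lemma reinforce_interval: "n \<ge> 1 \<Longrightarrow> reinforce {1..n} = {1..Suc n}"
  by (subst reinforce_def, subst Min_eqI[of _ 1]) (auto simp: image_Suc_atLeastAtMost)

text \<open>Shifting moves the gap from \<open>i\<close> to \<open>Suc i\<close> and leaves 1 free.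
  The added minimum is 1 if \<open>i\<close> is not 1, and the gap stays at \<open>Suc i\<close>; if
  \<open>i = 1\<close> the minimum is 2, which fills the gap at 2 and leaves one at 1. The index 2
  is never reached.\<close>

lemma reinforce_exch:
  assumes i: "i \<in> {1..n}" and t: "t \<in> {n<..2 * n}"
  shows "reinforce (exch n i t) = exch (Suc n) (if i = 1 then 1 else Suc i) (Suc t)"
proof -
  have shift: "Suc ` exch n i t = insert (Suc t) ({2..Suc n} - {Suc i})"
    by (simp add: exch_def image_set_diff image_Suc_atLeastAtMost numeral_2_eq_2)
  show ?thesis
  proof (cases "i = 1")
    case i1: True
    have "Min (exch n i t) = 2"
    \<comment> \<open>For \<open>n = 1\<close> the set is \<open>{2}\<close>, so the minimum is
      \<open>t\<close> itself; otherwise 2 belongs to \<open>{1..n} - {1}\<close>.\<close>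
    proof (cases "n = 1")
      case True
      with i1 t show ?thesis by (simp add: exch_def)
    next
      case False
      with i1 i t show ?thesis by (intro Min_eqI) (auto simp: exch_def)
    qed
    with i i1 t show ?thesis unfolding reinforce_def shift by (auto simp: exch_def)
  next
    case False
    with i t have "Min (exch n i t) = 1" by (intro Min_eqI) (auto simp: exch_def)
    with False i t show ?thesis unfolding reinforce_def shift by (auto simp: exch_def)
  qed
qed

text \<open>The carrier that goes with \<open>exch_order\<close>; \<open>I = {1..m}\<close> and
  \<open>v = 2 * m\<close> give all bases.\<close>

definition exch_sets :: "nat \<Rightarrow> nat set \<Rightarrow> nat \<Rightarrow> nat set set" where
  "exch_sets m I v = {{1..m}} \<union> {exch m i t | i t. i \<in> I \<and> t \<in> {m<..v}}"

lemma exch_sets_Suc: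
  assumes "m \<le> v"
  shows "exch_sets m I (Suc v) = exch_sets m I v \<union> {exch m i (Suc v) | i. i \<in> I}"
proof -
  have "t \<in> {m<..Suc v} \<longleftrightarrow> t \<in> {m<..v} \<or> t = Suc v" for t using assms by auto
  then show ?thesis unfolding exch_sets_def by (simp only:) blast
qed

lemma exch_sets_insert:
  "exch_sets m (insert k I) v = exch_sets m I v \<union> {exch m k t | t. t \<in> {m<..v}}"
  by (auto simp: exch_sets_def)

text \<open>Surjectivity of the index map of \<open>reinforce\<close> onto everything but 2; the
  preimage of 1 is 1, that of any other \<open>j\<close> is \<open>j - 1\<close>.\<close>

lemma reinforce_index:
  assumes "j \<in> {1..Suc n} - {2}" "n \<ge> 1"
  obtains i where "i \<in> {1..n}" "j = (if i = 1 then 1 else Suc i)"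
proof
  show "(if j = 1 then 1 else j - 1) \<in> {1..n}"
    "j = (if (if j = 1 then 1 else j - 1) = 1 then 1 else Suc (if j = 1 then 1 else j - 1))"
    using assms by auto
qed

lemma reinforce_exch_sets:
  assumes n: "n \<ge> 1"
  shows "reinforce ` exch_sets n {1..n} (2 * n) = exch_sets (Suc n) ({1..Suc n} - {2}) (2 * n + 1)"
proof (intro equalityI subsetI)
  fix B assume "B \<in> reinforce ` exch_sets n {1..n} (2 * n)"
  then consider "B = reinforce {1..n}"
    | i t where "i \<in> {1..n}" "t \<in> {n<..2 * n}" "B = reinforce (exch n i t)"
    unfolding exch_sets_def by blast
  then show "B \<in> exch_sets (Suc n) ({1..Suc n} - {2}) (2 * n + 1)"
  proof cases
    case 1
    then show ?thesis unfolding exch_sets_def reinforce_interval[OF n] by blast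
  next
    case 2
    let ?j = "if i = 1 then 1 else Suc i"
    have "?j \<in> {1..Suc n} - {2}" "Suc t \<in> {Suc n<..2 * n + 1}" using 2 by auto
    then show ?thesis
      using 2(3) unfolding exch_sets_def reinforce_exch[OF 2(1,2)] by blast
  qed
next
  fix B assume "B \<in> exch_sets (Suc n) ({1..Suc n} - {2}) (2 * n + 1)"
  then consider "B = {1..Suc n}"
    | j u where "j \<in> {1..Suc n} - {2}" "u \<in> {Suc n<..2 * n + 1}" "B = exch (Suc n) j u"
    unfolding exch_sets_def by blast
  then show "B \<in> reinforce ` exch_sets n {1..n} (2 * n)"
  proof cases
    case 1
    then show ?thesis unfolding exch_sets_def reinforce_interval[OF n, symmetric] by blast
  next
    case 2
    from reinforce_index[OF 2(1) n] obtain i where i: "i \<in> {1..n}" "j = (if i = 1 then 1 else Suc i)" .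
    from 2(2) obtain t where t: "t \<in> {n<..2 * n}" "u = Suc t" by (cases u) auto
    have "B = reinforce (exch n i t)"
      unfolding reinforce_exch[OF i(1) t(1)] 2(3) i(2) t(2) ..
    then show ?thesis using i(1) t(1) unfolding exch_sets_def by blast
  qed
qed

text \<open>Heights shift by 1, and the index map is injective and fixes 1, so the condition
  \<open>k = i \<or> k = 1\<close> is preserved and reflected.\<close>

lemma transport_reinforce_exch_order:
  assumes n: "n \<ge> 1"
  shows "transport reinforce (exch_sets n {1..n} (2 * n)) (exch_order n {1..n} (2 * n)) =
    exch_order (Suc n) ({1..Suc n} - {2}) (2 * n + 1)"
proof (intro equalityI subrelI)
  fix A B
  assume "(A, B) \<in> transport reinforce (exch_sets n {1..n} (2 * n)) (exch_order n {1..n} (2 * n))"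
  then obtain A' B' where "(A', B') \<in> exch_order n {1..n} (2 * n)"
    and AB: "A = reinforce A'" "B = reinforce B'"
    unfolding transport_def by blast
  then show "(A, B) \<in> exch_order (Suc n) ({1..Suc n} - {2}) (2 * n + 1)"
  proof cases
    case interval
    then show ?thesis unfolding AB by (simp only: reinforce_interval[OF n] exch_order.interval)
  next
    case (interval_exch u)
    then have "reinforce (exch n 1 u) = exch (Suc n) 1 (Suc u)"
      using reinforce_exch[of 1 n u] n by simp
    with interval_exch show ?thesis
      unfolding AB by (simp only: reinforce_interval[OF n]) (rule exch_order.interval_exch, auto)
  next
    case (exch_exch i k t u)
    then have k: "k \<in> {1..n}" and t: "t \<in> {n<..2 * n}" and u: "u \<in> {n<..2 * n}" using n by auto
    show ?thesis
      unfolding AB exch_exch(1,2) reinforce_exch[OF exch_exch(3) t] reinforce_exch[OF k u]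
      by (rule exch_order.exch_exch) (use exch_exch in auto)
  qed
next
  fix A B assume "(A, B) \<in> exch_order (Suc n) ({1..Suc n} - {2}) (2 * n + 1)"
  then obtain A' B' where "A' \<in> exch_sets n {1..n} (2 * n)" "B' \<in> exch_sets n {1..n} (2 * n)"
    "(A', B') \<in> exch_order n {1..n} (2 * n)" "A = reinforce A'" "B = reinforce B'"
  proof cases
    case interval
    show thesis
      by (rule that[of "{1..n}" "{1..n}"])
        (simp_all only: interval reinforce_interval[OF n] exch_order.interval, simp_all add: exch_sets_def)
  next
    case (interval_exch u)
    then obtain t where t: "t \<in> {n<..2 * n}" "u = Suc t" by (cases u) auto
    have one: "1 \<in> {1..n}" using n by simp
    show thesis
    proof (rule that)
      show "{1..n} \<in> exch_sets n {1..n} (2 * n)" "exch n 1 t \<in> exch_sets n {1..n} (2 * n)"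
        using t one unfolding exch_sets_def by blast+
      show "({1..n}, exch n 1 t) \<in> exch_order n {1..n} (2 * n)"
        by (rule exch_order.interval_exch) (use t in auto)
      show "A = reinforce {1..n}" using interval_exch reinforce_interval[OF n] by simp
      show "B = reinforce (exch n 1 t)" using interval_exch reinforce_exch[OF one t(1)] t by simp
    qed
  next
    case (exch_exch j k t u)
    from reinforce_index[OF exch_exch(3) n] obtain i
      where i: "i \<in> {1..n}" "j = (if i = 1 then 1 else Suc i)" .
    \<comment> \<open>The preimage of \<open>k\<close> is \<open>i\<close> if \<open>k = j\<close>,
      and 1 if \<open>k = 1\<close>.\<close>
    obtain k' where k': "k' = i \<or> k' = 1" "k = (if k' = 1 then 1 else Suc k')"
      using i(2) exch_exch(4) by metis
    then have k'n: "k' \<in> {1..n}" using i n by auto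
    obtain t' u' where tu: "t = Suc t'" "u = Suc u'" using exch_exch by (cases t; cases u) auto
    then have t': "t' \<in> {n<..2 * n}" and u': "u' \<in> {n<..2 * n}" using exch_exch by auto
    show thesis
    proof (rule that)
      show "exch n i t' \<in> exch_sets n {1..n} (2 * n)" "exch n k' u' \<in> exch_sets n {1..n} (2 * n)"
        using i k'n t' u' unfolding exch_sets_def by blast+
      show "(exch n i t', exch n k' u') \<in> exch_order n {1..n} (2 * n)"
        by (rule exch_order.exch_exch) (use i k' t' u' tu exch_exch in auto)
      show "A = reinforce (exch n i t')"
        unfolding reinforce_exch[OF i(1) t'] exch_exch(1) i(2) tu(1) ..
      show "B = reinforce (exch n k' u')"
        unfolding reinforce_exch[OF k'n u'] exch_exch(2) k'(2) tu(2) ..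
    qed
  qed
  then show "(A, B) \<in> transport reinforce (exch_sets n {1..n} (2 * n)) (exch_order n {1..n} (2 * n))"
    unfolding transport_def by blast
qed

lemma build_up_exch: "n \<ge> 1 \<Longrightarrow> build_up n (exch (Suc n) i (2 * n + 1)) = exch (Suc n) i (2 * n + 2)"
  by (auto simp: build_up_def exch_def)

text \<open>Putting 1 in place of 2 moves the gap from 1 to 2: the spine is copied to the chain that
  reinforcing missed.\<close>

lemma grow_spine_exch: "m \<ge> 2 \<Longrightarrow> m < t \<Longrightarrow> grow_spine (exch m 1 t) = exch m 2 t"
  by (auto simp: grow_spine_def exch_def)

theorem mainTheorem1:
  fixes n :: nat
  assumes "n \<ge> 1"
  shows "gamma n (ext_poset (trivial_uip n)) = ext_poset (trivial_uip (n + 1))"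
proof -
  define m where "m = Suc n"
  \<comment> \<open>The indices reached by reinforcing. The definitions below name the successive
    sets and relations inside \<open>gamma\<close>.\<close>
  define I where "I = {1..m} - {2}"
  have m: "m \<ge> 2" "m < 2 * n + 1" and mv: "2 * n + 2 = 2 * m" using assms by (auto simp: m_def)
  have one: "1 \<in> I" using m by (simp add: I_def)
  define S1 where "S1 = exch_sets m I (2 * n + 1)"
  define R1 where "R1 = exch_order m I (2 * n + 1)"
  define D2 where "D2 = {B \<in> S1. 2 * n + 1 \<in> B}"
  define S2 where "S2 = S1 \<union> build_up n ` D2"
  define R2 where "R2 = R1 \<union> {(B, build_up n B) | B. B \<in> D2} \<union> transport (build_up n) D2 R1"
  define D3 where "D3 = {B \<in> S2. 2 \<in> B \<and> 1 \<notin> B}"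
  define S3 where "S3 = S2 \<union> grow_spine ` D3"
  define R3 where "R3 = R2 \<union> {(grow_spine B, B) | B. B \<in> D3} \<union> transport grow_spine D3 R2"
  let ?R = "exch_order m {1..m} (2 * m)"

  \<comment> \<open>The sets produced by the three steps\<close>
  have top1: "2 * n + 1 \<in> exch m i t \<longleftrightarrow> t = 2 * n + 1" for i t
    using m by (auto simp: exch_def)
  have top0: "2 * n + 1 \<notin> {1..m}" using m by simp
  have low: "1 \<in> exch m i t \<longleftrightarrow> i \<noteq> 1" if "m < t" for i t
    using m that by (auto simp: exch_def)
  have low2: "2 \<in> exch m 1 t" for t using m by (auto simp: exch_def)
  have build: "build_up n (exch m i (2 * n + 1)) = exch m i (2 * n + 2)" for i
    unfolding m_def using build_up_exch[OF assms] .
  have D2: "D2 = {exch m i (2 * n + 1) | i. i \<in> I}"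
  proof (intro equalityI subsetI)
    fix B assume "B \<in> D2"
    then have "B \<in> exch_sets m I (2 * n + 1)" "2 * n + 1 \<in> B" unfolding D2_def S1_def by blast+
    with top0 obtain i t where it: "i \<in> I" "B = exch m i t" unfolding exch_sets_def by blast
    with \<open>2 * n + 1 \<in> B\<close> top1 have "t = 2 * n + 1" by blast
    with it show "B \<in> {exch m i (2 * n + 1) | i. i \<in> I}" by blast
  next
    fix B assume "B \<in> {exch m i (2 * n + 1) | i. i \<in> I}"
    then obtain i where i: "i \<in> I" "B = exch m i (2 * n + 1)" by blast
    have "2 * n + 1 \<in> {m<..2 * n + 1}" using m by simp
    with i have "B \<in> S1" unfolding S1_def exch_sets_def by blast
    moreover have "2 * n + 1 \<in> B" unfolding i(2) top1 ..
    ultimately show "B \<in> D2" unfolding D2_def by blast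
  qed
  have S2: "S2 = exch_sets m I (2 * m)"
  proof -
    have "build_up n ` D2 = {exch m i (2 * n + 2) | i. i \<in> I}"
      unfolding D2 Setcompr_eq_image image_image build ..
    moreover have "2 * m = Suc (2 * n + 1)" "Suc (2 * n + 1) = 2 * n + 2" "m \<le> 2 * n + 1"
      using m mv by simp_all
    ultimately show ?thesis
      unfolding S2_def S1_def using exch_sets_Suc[of m "2 * n + 1" I] by (simp only:)
  qed
  \<comment> \<open>A set in \<open>S2\<close> lacks 1 just when it is exchanged at
    \<open>i = 1\<close>, and then it contains 2 because \<open>m \<ge> 2\<close>. So the copied
    sets are the spine above \<open>{1..m}\<close>.\<close>
  have D3: "D3 = {exch m 1 t | t. t \<in> {m<..2 * m}}"
  proof (intro equalityI subsetI)
    fix B assume "B \<in> D3"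
    then have B: "B \<in> exch_sets m I (2 * m)" "1 \<notin> B" by (simp_all add: D3_def S2)
    have "1 \<in> {1..m}" using m by simp
    with B obtain i t where it: "t \<in> {m<..2 * m}" "B = exch m i t" unfolding exch_sets_def by blast
    with B(2) low[of t i] have "i = 1" by simp
    with it show "B \<in> {exch m 1 t | t. t \<in> {m<..2 * m}}" by blast
  next
    fix B assume "B \<in> {exch m 1 t | t. t \<in> {m<..2 * m}}"
    then obtain t where t: "t \<in> {m<..2 * m}" "B = exch m 1 t" by blast
    then have "B \<in> S2" using one unfolding S2 exch_sets_def by blast
    moreover have "1 \<notin> B" using t low[of t 1] by simp
    ultimately show "B \<in> D3" using t low2[of t] by (simp add: D3_def)
  qed
  have grow: "grow_spine (exch m 1 t) = exch m 2 t" if "m < t" for t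
    using grow_spine_exch[OF m(1) that] .
  have S3: "S3 = exch_sets m {1..m} (2 * m)"
  proof -
    have "grow_spine ` D3 = {exch m 2 t | t. t \<in> {m<..2 * m}}"
    proof (intro equalityI subsetI)
      fix B assume "B \<in> grow_spine ` D3"
      then obtain t where "t \<in> {m<..2 * m}" "B = grow_spine (exch m 1 t)" unfolding D3 by blast
      with grow[of t] show "B \<in> {exch m 2 t | t. t \<in> {m<..2 * m}}" by auto
    next
      fix B assume "B \<in> {exch m 2 t | t. t \<in> {m<..2 * m}}"
      then obtain t where "t \<in> {m<..2 * m}" "B = exch m 2 t" by blast
      moreover from this have "B = grow_spine (exch m 1 t)" using grow[of t] by simp
      ultimately show "B \<in> grow_spine ` D3" unfolding D3 by blast
    qed
    moreover have "{1..m} = insert 2 I" using m unfolding I_def by auto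
    ultimately show ?thesis unfolding S3_def S2 by (simp only: exch_sets_insert)
  qed

  \<comment> \<open>Recorded relations hold in the external order\<close>
  have Isub: "I \<subseteq> {1..m}" by (auto simp: I_def)
  have R2_sub: "R2 \<subseteq> exch_order m I (2 * m)"
  proof -
    have "R1 \<subseteq> exch_order m I (2 * m)"
      unfolding R1_def by (rule exch_order_mono) (simp_all add: mv[symmetric])
    moreover have "{(B, build_up n B) | B. B \<in> D2} \<subseteq> exch_order m I (2 * m)"
    proof (rule subrelI)
      fix A B assume "(A, B) \<in> {(B, build_up n B) | B. B \<in> D2}"
      then obtain i where i: "i \<in> I" "A = exch m i (2 * n + 1)" "B = exch m i (2 * n + 2)"
        unfolding D2 using build by auto
      show "(A, B) \<in> exch_order m I (2 * m)"
        unfolding i(2,3) by (rule exch_order.exch_exch) (use i m mv in auto)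
    qed
    moreover have "transport (build_up n) D2 R1 \<subseteq> exch_order m I (2 * m)"
    proof (rule subrelI)
      fix A B assume "(A, B) \<in> transport (build_up n) D2 R1"
      then obtain A' B' where "(A', B') \<in> R1" and in_D2: "2 * n + 1 \<in> A'" "2 * n + 1 \<in> B'"
        and AB: "A = build_up n A'" "B = build_up n B'"
        unfolding transport_def D2_def by blast
      from this(1) show "(A, B) \<in> exch_order m I (2 * m)"
        unfolding R1_def
      proof cases
        case (exch_exch i k t u)
        \<comment> \<open>Both sets of a copied pair have height \<open>2 * n + 1\<close>, so the
          copies both have height \<open>2 * n + 2\<close>.\<close>
        then have "t = 2 * n + 1" "u = 2 * n + 1" using in_D2 top1 by blast+
        then have AB': "A = exch m i (2 * n + 2)" "B = exch m k (2 * n + 2)"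
          using AB exch_exch build by auto
        show ?thesis
          unfolding AB' by (rule exch_order.exch_exch) (use exch_exch m mv in auto)
      qed (use in_D2(1) top0 in blast)+
    qed
    ultimately show ?thesis unfolding R2_def by blast
  qed
  have R3_sub: "R3 \<subseteq> ?R"
  proof -
    have two: "2 \<in> {1..m}" using m by simp
    have "R2 \<subseteq> ?R" using R2_sub exch_order_mono[OF Isub order_refl] by blast
    moreover have "{(grow_spine B, B) | B. B \<in> D3} \<subseteq> ?R"
    proof (rule subrelI)
      fix A B assume "(A, B) \<in> {(grow_spine B, B) | B. B \<in> D3}"
      then obtain t where t: "t \<in> {m<..2 * m}" "A = exch m 2 t" "B = exch m 1 t"
        unfolding D3 using grow by auto
      show "(A, B) \<in> ?R"
        unfolding t(2,3) by (rule exch_order.exch_exch) (use t two in auto)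
    qed
    moreover have "transport grow_spine D3 R2 \<subseteq> ?R"
    proof (rule subrelI)
      fix A B assume "(A, B) \<in> transport grow_spine D3 R2"
      then obtain A' B' where "(A', B') \<in> exch_order m I (2 * m)" and in_D3: "1 \<notin> A'" "1 \<notin> B'"
        and AB: "A = grow_spine A'" "B = grow_spine B'"
        unfolding transport_def D3_def using R2_sub by blast
      have low0: "1 \<in> {1..m}" using m by simp
      from \<open>(A', B') \<in> exch_order m I (2 * m)\<close> show "(A, B) \<in> ?R"
      proof cases
        case (exch_exch i k t u)
        \<comment> \<open>Both sets lie on the spine, so their copies are compared within the chain
          of index 2.\<close>
        then have "i = 1" "k = 1" using in_D3 low[of t i] low[of u k] by auto
        then have AB': "A = exch m 2 t" "B = exch m 2 u"
          using AB exch_exch grow[of t] grow[of u] by auto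
        show ?thesis
          unfolding AB' by (rule exch_order.exch_exch) (use exch_exch two in auto)
      qed (use in_D3(1) low0 in blast)+
    qed
    ultimately show ?thesis unfolding R3_def by blast
  qed

  \<comment> \<open>Recorded relations generate the external order\<close>
  have R1_R3: "R1 \<subseteq> R3" and R2_R3: "R2 \<subseteq> R3" unfolding R2_def R3_def by blast+
  have in_R1: "(exch m i t, exch m k u) \<in> R1"
    if "i \<in> I" "k = i \<or> k = 1" "m < t" "t \<le> u" "u \<le> 2 * n + 1" for i k t u
    unfolding R1_def using that by (rule exch_order.exch_exch)
  have build_R2: "(exch m i (2 * n + 1), exch m i (2 * n + 2)) \<in> R2" if "i \<in> I" for i
  proof -
    have "exch m i (2 * n + 1) \<in> D2" using that unfolding D2 by blast
    then have "(exch m i (2 * n + 1), build_up n (exch m i (2 * n + 1))) \<in> R2"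
      unfolding R2_def by blast
    then show ?thesis unfolding build .
  qed
  have spine_R3: "(exch m 2 t, exch m 2 u) \<in> R3"
    if "(exch m 1 t, exch m 1 u) \<in> R2" "t \<in> {m<..2 * m}" "u \<in> {m<..2 * m}" for t u
  proof -
    have "exch m 1 t \<in> D3" "exch m 1 u \<in> D3" using that unfolding D3 by blast+
    then have "(grow_spine (exch m 1 t), grow_spine (exch m 1 u)) \<in> R3"
      using that(1) unfolding R3_def transport_def by blast
    then show ?thesis using grow[of t] grow[of u] that by simp
  qed
  \<comment> \<open>Climbing one chain: reinforcing covers heights up to \<open>2 * n + 1\<close>
    and building up gives the last step. For \<open>i = 2\<close> both are copied from the
    spine.\<close>
  have row: "(exch m i t, exch m i u) \<in> R3\<^sup>*"
    if i: "i \<in> {1..m}" and tu: "m < t" "t \<le> u" "u \<le> 2 * n + 2" for i t u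
  proof -
    have inner: "(exch m i t, exch m i u) \<in> R3" if "t \<le> u" "m < t" "u \<le> 2 * n + 1" for t u
    proof (cases "i = 2")
      case True
      have "(exch m 1 t, exch m 1 u) \<in> R2" using in_R1[OF one] that unfolding R2_def by blast
      then show ?thesis unfolding True by (rule spine_R3) (use that mv in auto)
    next
      case False
      then have "i \<in> I" using i by (simp add: I_def)
      then show ?thesis using in_R1 R1_R3 that by blast
    qed
    have last: "(exch m i (2 * n + 1), exch m i (2 * n + 2)) \<in> R3"
    proof (cases "i = 2")
      case True
      show ?thesis unfolding True by (rule spine_R3[OF build_R2[OF one]]) (use m mv in auto)
    next
      case False
      then have "i \<in> I" using i by (simp add: I_def)
      then show ?thesis using build_R2 R2_R3 by blast
    qed
    consider "u \<le> 2 * n + 1" | "t = u" | "u = 2 * n + 2" "t \<le> 2 * n + 1" using tu by linarith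
    then show ?thesis
    proof cases
      case 1
      then show ?thesis using inner tu by blast
    next
      case 3
      then have "(exch m i t, exch m i (2 * n + 1)) \<in> R3" using inner tu by blast
      then show ?thesis using last unfolding 3 by (meson converse_rtrancl_into_rtrancl r_into_rtrancl)
    qed simp
  qed
  \<comment> \<open>Crossing to the spine at fixed height: recorded by \<open>grow_spine\<close> for
    \<open>i = 2\<close>, by reinforcing for \<open>u \<le> 2 * n + 1\<close>, and at
    \<open>u = 2 * n + 2\<close> as the \<open>build_up\<close> copy of the crossing just
    below.\<close>
  have column: "(exch m i u, exch m 1 u) \<in> R3\<^sup>*" if i: "i \<in> {1..m}" and u: "u \<in> {m<..2 * m}" for i u
  proof (cases "i = 2")
    case True
    have "exch m 1 u \<in> D3" using u unfolding D3 by blast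
    then have "(grow_spine (exch m 1 u), exch m 1 u) \<in> R3" unfolding R3_def by blast
    then show ?thesis using True grow[of u] u by auto
  next
    case False
    then have iI: "i \<in> I" using i by (simp add: I_def)
    show ?thesis
    proof (cases "u \<le> 2 * n + 1")
      case True
      then have "(exch m i u, exch m 1 u) \<in> R1" by (intro in_R1) (use iI u in auto)
      then show ?thesis using R1_R3 by blast
    next
      case False
      then have u': "u = 2 * n + 2" using u mv by simp
      have "(exch m i (2 * n + 1), exch m 1 (2 * n + 1)) \<in> R1" by (intro in_R1) (use iI m in auto)
      moreover have "exch m i (2 * n + 1) \<in> D2" "exch m 1 (2 * n + 1) \<in> D2"
        using iI one unfolding D2 by blast+
      ultimately have "(build_up n (exch m i (2 * n + 1)), build_up n (exch m 1 (2 * n + 1))) \<in> R2"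
        unfolding R2_def transport_def by blast
      then show ?thesis unfolding build u' using R2_R3 by blast
    qed
  qed
  have sub_R3: "?R \<subseteq> R3\<^sup>*"
  proof (rule subrelI)
    fix A B assume "(A, B) \<in> ?R"
    then show "(A, B) \<in> R3\<^sup>*"
    proof cases
      case interval
      then show ?thesis by simp
    next
      case (interval_exch u)
      \<comment> \<open>Since \<open>m < 2 * n + 1\<close>, the height \<open>Suc m\<close> already
        occurs after reinforcing.\<close>
      have "({1..m}, exch m 1 (Suc m)) \<in> R1"
        unfolding R1_def by (rule exch_order.interval_exch) (use m in auto)
      moreover have "(exch m 1 (Suc m), exch m 1 u) \<in> R3\<^sup>*"
        by (rule row) (use interval_exch m mv in auto)
      ultimately show ?thesis
        unfolding interval_exch(1,2) using R1_R3 by (meson converse_rtrancl_into_rtrancl subsetD)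
    next
      case (exch_exch i k t u)
      \<comment> \<open>Climb within chain \<open>i\<close> first, then cross to the spine if
        \<open>k = 1\<close>.\<close>
      have "(exch m i t, exch m i u) \<in> R3\<^sup>*" by (rule row) (use exch_exch mv in auto)
      moreover have "(exch m i u, exch m 1 u) \<in> R3\<^sup>*" by (rule column) (use exch_exch in auto)
      ultimately show ?thesis
        using exch_exch(1,2,4) by (metis rtrancl_trans)
    qed
  qed

  \<comment> \<open>Equality of the generated order and the external order\<close>
  have "R3\<^sup>* \<subseteq> ?R\<^sup>="
  proof -
    have "R3\<^sup>* \<subseteq> ?R\<^sup>*" using R3_sub by (rule rtrancl_mono)
    also have "\<dots> = ?R\<^sup>=" using trans_exch_order[of "{1..m}" m "2 * m"] m
      by (simp add: rtrancl_trancl_reflcl)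
    finally show ?thesis .
  qed
  \<comment> \<open>The closure contains the identity on all sets; after restriction to
    \<open>S3\<close> only pairs remain on which \<open>?R\<close> is reflexive.\<close>
  moreover have "Id \<inter> S3 \<times> S3 \<subseteq> ?R"
  proof
    fix p assume "p \<in> Id \<inter> S3 \<times> S3"
    then obtain B where p: "p = (B, B)" and "B \<in> S3" by auto
    then consider "B = {1..m}" | i t where "i \<in> {1..m}" "t \<in> {m<..2 * m}" "B = exch m i t"
      unfolding S3 exch_sets_def by blast
    then show "p \<in> ?R"
    proof cases
      case 1
      then show ?thesis unfolding p by (simp only: exch_order.interval)
    next
      case 2
      then show ?thesis unfolding p 2(3) by (intro exch_order.exch_exch) auto
    qed
  qed
  moreover have "?R \<subseteq> S3 \<times> S3"
  proof (rule subrelI)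
    fix A B assume "(A, B) \<in> ?R"
    then show "(A, B) \<in> S3 \<times> S3"
    proof cases
      case interval
      then show ?thesis by (simp add: S3 exch_sets_def)
    next
      case (interval_exch u)
      then have "u \<in> {m<..2 * m}" "1 \<in> {1..m}" using m by auto
      with interval_exch show ?thesis unfolding S3 exch_sets_def by blast
    next
      case (exch_exch i k t u)
      then have "t \<in> {m<..2 * m}" "u \<in> {m<..2 * m}" "k \<in> {1..m}" by auto
      with exch_exch show ?thesis unfolding S3 exch_sets_def by blast
    qed
  qed
  ultimately have order: "R3\<^sup>* \<inter> S3 \<times> S3 = ?R" using sub_R3 by blast

  have bases: "bases (trivial_uip k) = exch_sets k {1..k} (2 * k)" for k
    by (simp only: bases_trivial_uip exch_sets_def)
  have start: "fst (ext_poset (trivial_uip n)) = exch_sets n {1..n} (2 * n)"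
    "snd (ext_poset (trivial_uip n)) = exch_order n {1..n} (2 * n)"
    unfolding ext_poset_trivial_uip[OF assms] bases by simp_all
  have "gamma n (ext_poset (trivial_uip n)) = (S3, R3\<^sup>* \<inter> S3 \<times> S3)"
    unfolding gamma_def Let_def start reinforce_exch_sets[OF assms]
      transport_reinforce_exch_order[OF assms] m_def[symmetric] I_def[symmetric]
      S1_def[symmetric] R1_def[symmetric]
      D2_def[symmetric] S2_def[symmetric] R2_def[symmetric]
      D3_def[symmetric] S3_def[symmetric] R3_def[symmetric] ..
  also have "\<dots> = (exch_sets m {1..m} (2 * m), ?R)" by (simp only: order[unfolded S3] S3)
  also have "\<dots> = ext_poset (trivial_uip (n + 1))"
    using ext_poset_trivial_uip[of "n + 1"] unfolding bases m_def by simp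
  finally show ?thesis .
qed

end
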